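(* For every graph $\Gamma$ there exists a graph $\Gamma'$ such that $\Gamma'$ admits a partial orientation as a quasi-transitive mixed graph and $\Gamma$ is an induced subgraph of $\Gamma'$.
   Context: A mixed graph has a vertex set, a set of (undirected) edges and a set of arcs, with at most one edge or arc between any pair of vertices. A partial orientation of a graph $\Gamma$ is a mixed graph obtained from $\Gamma$ by orienting some (possibly none or all) of its edges as arcs. A $2$-dipath is a directed path $uvw$ consisting of arcs $u\to v$ and $v\to w$; it is induced if $u$ and $w$ are not joined by an edge or arc. A mixed graph $H$ is quasi-transitive when (1) $H$ has no induced $2$-dipath, and (2) for every edge $uv$ of $H$ there is a vertex $w$ such that $uwv$ or $vwu$ is a $2$-dipath. *)

theory Defs
  imports Main
begin

record 'a ugraph =
  verts :: "'a set"
  edges :: "'a set set"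

definition simple_graph :: "('a, 'b) ugraph_scheme \<Rightarrow> bool" where
  "simple_graph G \<longleftrightarrow>
     (\<forall>e\<in>edges G. \<exists>u v. u \<in> verts G \<and> v \<in> verts G \<and> u \<noteq> v \<and> e = {u, v})"

definition induced_subgraph :: "'a ugraph \<Rightarrow> 'a ugraph \<Rightarrow> bool" where
  "induced_subgraph H G \<longleftrightarrow>
     verts H \<subseteq> verts G \<and> edges H = {e \<in> edges G. e \<subseteq> verts H}"

definition relabel :: "('a \<Rightarrow> 'b) \<Rightarrow> 'a ugraph \<Rightarrow> 'b ugraph" where
  "relabel f G = \<lparr>verts = f ` verts G, edges = (\<lambda>e. f ` e) ` edges G\<rparr>"

text \<open>In a mixed graph, \<open>edges\<close> holds only the undirected edges;
  \<open>(u, v) \<in> arcs M\<close> is the arc from \<open>u\<close> to \<open>v\<close>.\<close>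

record 'a mgraph = "'a ugraph" +
  arcs :: "('a \<times> 'a) set"

definition mixed_graph :: "'a mgraph \<Rightarrow> bool" where
  "mixed_graph M \<longleftrightarrow>
     simple_graph M \<and>
     (\<forall>u v. (u, v) \<in> arcs M \<longrightarrow>
        u \<in> verts M \<and> v \<in> verts M \<and> u \<noteq> v \<and>
        {u, v} \<notin> edges M \<and> (v, u) \<notin> arcs M)"

definition partial_orientation :: "'a mgraph \<Rightarrow> 'a ugraph \<Rightarrow> bool" where
  "partial_orientation M G \<longleftrightarrow>
     mixed_graph M \<and> verts M = verts G \<and>
     edges G = edges M \<union> {{u, v} | u v. (u, v) \<in> arcs M}"

definition joined :: "'a mgraph \<Rightarrow> 'a \<Rightarrow> 'a \<Rightarrow> bool" where
  "joined M u v \<longleftrightarrow> {u, v} \<in> edges M \<or> (u, v) \<in> arcs M \<or> (v, u) \<in> arcs M"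

definition two_dipath :: "'a mgraph \<Rightarrow> 'a \<Rightarrow> 'a \<Rightarrow> 'a \<Rightarrow> bool" where
  "two_dipath M u v w \<longleftrightarrow> (u, v) \<in> arcs M \<and> (v, w) \<in> arcs M \<and> u \<noteq> w"

definition induced_two_dipath :: "'a mgraph \<Rightarrow> 'a \<Rightarrow> 'a \<Rightarrow> 'a \<Rightarrow> bool" where
  "induced_two_dipath M u v w \<longleftrightarrow> two_dipath M u v w \<and> \<not> joined M u w"

definition quasi_transitive :: "'a mgraph \<Rightarrow> bool" where
  "quasi_transitive M \<longleftrightarrow>
     mixed_graph M \<and>
     (\<nexists>u v w. induced_two_dipath M u v w) \<and>
     (\<forall>u v. {u, v} \<in> edges M \<longrightarrow> (\<exists>w. two_dipath M u w v \<or> two_dipath M v w u))"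

end

theory Submission
  imports Defs
begin

text \<open>In an orientation of a triangle-free graph every 2-dipath is induced, so joining the ends of
  each 2-dipath by an undirected edge never conflicts with an arc. The result is quasi-transitive:
  the new edges close exactly the 2-dipaths that witness them, and since no arc is added no new
  2-dipath arises. Subdividing the arcs of an arbitrary orientation of \<open>\<Gamma>\<close> gives an oriented
  bipartite graph; each arc \<open>u \<rightarrow> v\<close> has become a 2-dipath from \<open>u\<close> to \<open>v\<close>, and no other 2-dipath
  joins two vertices of \<open>\<Gamma>\<close>. Joining the ends of the 2-dipaths therefore restores \<open>\<Gamma>\<close> as an
  induced subgraph.\<close>

definition unordered_pairs :: "'a rel \<Rightarrow> 'a set set" where
  "unordered_pairs r = (\<lambda>(u, v). {u, v}) ` r"

lemma doubleton_in_unordered_pairs_iff: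
  "{u, v} \<in> unordered_pairs r \<longleftrightarrow> (u, v) \<in> r \<or> (v, u) \<in> r"
  by (auto simp: unordered_pairs_def image_iff doubleton_eq_iff)

lemma unordered_pairs_Un: "unordered_pairs (r \<union> s) = unordered_pairs r \<union> unordered_pairs s"
  by (simp add: unordered_pairs_def image_Un)

lemma unordered_pairs_map_prod:
  "unordered_pairs (map_prod f f ` r) = image f ` unordered_pairs r"
  by (simp add: unordered_pairs_def image_image split_beta)

lemma unordered_pairs_Int_Times:
  "unordered_pairs (r \<inter> S \<times> S) = {e \<in> unordered_pairs r. e \<subseteq> S}"
  by (auto simp: unordered_pairs_def)

lemma simple_graph_iff:
  "simple_graph G \<longleftrightarrow>
     (\<exists>r. irrefl r \<and> r \<subseteq> verts G \<times> verts G \<and> edges G = unordered_pairs r)"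
proof
  assume simple: "simple_graph G"
  let ?r = "{(u, v). u \<in> verts G \<and> v \<in> verts G \<and> u \<noteq> v \<and> {u, v} \<in> edges G}"
  have "edges G = unordered_pairs ?r"
  proof (intro equalityI subsetI)
    fix e
    assume "e \<in> edges G"
    then obtain u v where "e = {u, v}" "(u, v) \<in> ?r"
      using simple by (auto simp: simple_graph_def)
    then show "e \<in> unordered_pairs ?r"
      by (auto simp: unordered_pairs_def)
  qed (auto simp: unordered_pairs_def)
  moreover have "irrefl ?r" "?r \<subseteq> verts G \<times> verts G"
    by (auto simp: irrefl_def)
  ultimately show "\<exists>r. irrefl r \<and> r \<subseteq> verts G \<times> verts G \<and> edges G = unordered_pairs r"
    by blast
next
  assume "\<exists>r. irrefl r \<and> r \<subseteq> verts G \<times> verts G \<and> edges G = unordered_pairs r"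
  then obtain r where r: "irrefl r" "r \<subseteq> verts G \<times> verts G"
    and edges: "edges G = unordered_pairs r"
    by blast
  have "u \<in> verts G \<and> v \<in> verts G \<and> u \<noteq> v" if "(u, v) \<in> r" for u v
    using that r by (auto simp: irrefl_def)
  then show "simple_graph G"
    unfolding simple_graph_def edges unordered_pairs_def by force
qed

definition underlying_graph :: "'a mgraph \<Rightarrow> 'a ugraph" where
  "underlying_graph M = \<lparr>verts = verts M, edges = edges M \<union> unordered_pairs (arcs M)\<rparr>"

lemma partial_orientation_underlying_graph:
  "mixed_graph M \<Longrightarrow> partial_orientation M (underlying_graph M)"
  by (auto simp: partial_orientation_def underlying_graph_def unordered_pairs_def)

lemma simple_graph_underlying_graph:
  assumes "mixed_graph M"
  shows "simple_graph (underlying_graph M)"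
proof -
  obtain r where "irrefl r" "r \<subseteq> verts M \<times> verts M" and edges: "edges M = unordered_pairs r"
    using assms unfolding mixed_graph_def simple_graph_iff by blast
  then have "irrefl (r \<union> arcs M)" "r \<union> arcs M \<subseteq> verts M \<times> verts M"
    using assms by (auto simp: mixed_graph_def irrefl_def)
  moreover have "edges (underlying_graph M) = unordered_pairs (r \<union> arcs M)"
    by (simp add: underlying_graph_def edges unordered_pairs_Un)
  moreover have "verts (underlying_graph M) = verts M"
    by (simp add: underlying_graph_def)
  ultimately show ?thesis
    unfolding simple_graph_iff by auto
qed

text \<open>Disjointness of \<open>A O A\<close> from \<open>Id\<close> excludes both loops and digons.\<close>

definition oriented_triangle_free :: "'a rel \<Rightarrow> bool" where
  "oriented_triangle_free A \<longleftrightarrow> A O A \<inter> (Id \<union> A \<union> A\<inverse>) = {}"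

definition dipath_closure :: "'a set \<Rightarrow> 'a rel \<Rightarrow> 'a mgraph" where
  "dipath_closure V A = \<lparr>verts = V \<union> Field A, edges = unordered_pairs (A O A), arcs = A\<rparr>"

lemma verts_dipath_closure: "verts (dipath_closure V A) = V \<union> Field A"
  and edges_dipath_closure: "edges (dipath_closure V A) = unordered_pairs (A O A)"
  and arcs_dipath_closure: "arcs (dipath_closure V A) = A"
  by (simp_all add: dipath_closure_def)

lemma mixed_graph_dipath_closure:
  assumes "oriented_triangle_free A"
  shows "mixed_graph (dipath_closure V A)"
proof -
  have "irrefl (A O A)"
    using assms by (auto simp: oriented_triangle_free_def irrefl_def)
  moreover have "A O A \<subseteq> (V \<union> Field A) \<times> (V \<union> Field A)"
    by (auto simp: Field_def)
  ultimately have "simple_graph (dipath_closure V A)"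
    unfolding simple_graph_iff verts_dipath_closure edges_dipath_closure by blast
  moreover have "u \<in> V \<union> Field A \<and> v \<in> V \<union> Field A \<and> u \<noteq> v \<and>
      {u, v} \<notin> unordered_pairs (A O A) \<and> (v, u) \<notin> A" if "(u, v) \<in> A" for u v
    using that assms
    by (auto simp: oriented_triangle_free_def doubleton_in_unordered_pairs_iff Field_def)
  ultimately show ?thesis
    by (simp add: mixed_graph_def verts_dipath_closure edges_dipath_closure arcs_dipath_closure)
qed

lemma two_dipath_dipath_closure_iff:
  assumes "oriented_triangle_free A"
  shows "two_dipath (dipath_closure V A) u v w \<longleftrightarrow> (u, v) \<in> A \<and> (v, w) \<in> A"
  using assms by (auto simp: two_dipath_def arcs_dipath_closure oriented_triangle_free_def)

lemma quasi_transitive_dipath_closure: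
  assumes "oriented_triangle_free A"
  shows "quasi_transitive (dipath_closure V A)"
proof -
  have "\<not> induced_two_dipath (dipath_closure V A) u v w" for u v w
    unfolding induced_two_dipath_def joined_def edges_dipath_closure
      doubleton_in_unordered_pairs_iff two_dipath_dipath_closure_iff[OF assms] by blast
  moreover have "\<exists>w. two_dipath (dipath_closure V A) u w v \<or> two_dipath (dipath_closure V A) v w u"
    if "{u, v} \<in> edges (dipath_closure V A)" for u v
    using that unfolding edges_dipath_closure doubleton_in_unordered_pairs_iff
      two_dipath_dipath_closure_iff[OF assms] by blast
  ultimately show ?thesis
    by (simp add: quasi_transitive_def mixed_graph_dipath_closure[OF assms])
qed

definition subdivision :: "'a rel \<Rightarrow> ('a + 'a list) rel" where
  "subdivision r = (\<Union>(u, v)\<in>r. {(Inl u, Inr [u, v]), (Inr [u, v], Inl v)})"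

lemma finite_subdivision: "finite r \<Longrightarrow> finite (subdivision r)"
  by (auto simp: subdivision_def)

lemma subdivision_relcomp_subdivision:
  "subdivision r O subdivision r =
     map_prod Inl Inl ` r \<union> {(Inr [u, v], Inr [v, w]) | u v w. (u, v) \<in> r \<and> (v, w) \<in> r}"
  by (auto simp: subdivision_def relcomp_unfold map_prod_def image_iff Bex_def)

lemma oriented_triangle_free_subdivision:
  assumes "irrefl r"
  shows "oriented_triangle_free (subdivision r)"
proof -
  have "subdivision r O subdivision r \<inter> Id = {}"
    using assms by (auto simp: subdivision_relcomp_subdivision irrefl_def)
  moreover have "subdivision r O subdivision r \<inter> (subdivision r \<union> (subdivision r)\<inverse>) = {}"
    unfolding subdivision_relcomp_subdivision by (auto simp: subdivision_def)
  ultimately show ?thesis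
    unfolding oriented_triangle_free_def by blast
qed

lemma induced_subgraph_dipath_closure_subdivision:
  assumes "r \<subseteq> verts G \<times> verts G" and edges_G: "edges G = unordered_pairs r"
  shows "induced_subgraph (relabel Inl G)
           (underlying_graph (dipath_closure (Inl ` verts G) (subdivision r)))"
    (is "induced_subgraph ?H ?K")
proof -
  let ?A = "subdivision r"
  have "edges ?H = unordered_pairs (map_prod Inl Inl ` r)"
    by (simp add: relabel_def edges_G unordered_pairs_map_prod)
  also have "map_prod Inl Inl ` r = (?A O ?A \<union> ?A) \<inter> verts ?H \<times> verts ?H"
    unfolding subdivision_relcomp_subdivision
    using assms(1) by (auto simp: subdivision_def relabel_def)
  also have "unordered_pairs \<dots> = {e \<in> edges ?K. e \<subseteq> verts ?H}"
    by (simp add: unordered_pairs_Int_Times unordered_pairs_Un underlying_graph_def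
        edges_dipath_closure arcs_dipath_closure)
  finally show ?thesis
    by (simp add: induced_subgraph_def underlying_graph_def verts_dipath_closure relabel_def)
qed

theorem theorem2p1:
  fixes \<Gamma> :: "'a ugraph"
  assumes "simple_graph \<Gamma>"
  shows "\<exists>\<Gamma>' :: ('a + 'a list) ugraph.
           simple_graph \<Gamma>' \<and>
           (finite (verts \<Gamma>) \<longrightarrow> finite (verts \<Gamma>')) \<and>
           (\<exists>M. partial_orientation M \<Gamma>' \<and> quasi_transitive M) \<and>
           induced_subgraph (relabel Inl \<Gamma>) \<Gamma>'"
proof -
  obtain r where "irrefl r" and r: "r \<subseteq> verts \<Gamma> \<times> verts \<Gamma>" "edges \<Gamma> = unordered_pairs r"
    using assms unfolding simple_graph_iff by blast
  let ?M = "dipath_closure (Inl ` verts \<Gamma>) (subdivision r)"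
  have triangle_free: "oriented_triangle_free (subdivision r)"
    using \<open>irrefl r\<close> by (rule oriented_triangle_free_subdivision)
  then have "quasi_transitive ?M"
    by (rule quasi_transitive_dipath_closure)
  moreover have "partial_orientation ?M (underlying_graph ?M)" "simple_graph (underlying_graph ?M)"
    using mixed_graph_dipath_closure[OF triangle_free]
    by (simp_all add: partial_orientation_underlying_graph simple_graph_underlying_graph)
  moreover have "induced_subgraph (relabel Inl \<Gamma>) (underlying_graph ?M)"
    using r by (rule induced_subgraph_dipath_closure_subdivision)
  moreover have "finite (verts (underlying_graph ?M))" if "finite (verts \<Gamma>)"
    using that finite_subset[OF r(1)]
    by (simp add: underlying_graph_def verts_dipath_closure finite_Field finite_subdivision)
  ultimately show ?thesis
    by blast
qed

end
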